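(* Let $\mathbf{A}=\mathbf{A}_0\circ\mathbf{S}$, where $\mathbf{A}_0$ is an arbitrary (possibly empty) composition of operators from $\{\mathbf{S},\mathbf{R}\}$. - For every permutation $\theta$ sorted by $\mathbf{S}\circ\mathbf{A}$, we have $\mathrm{zeil}(\Phi_{\mathbf{A}}(\theta))=\mathrm{zeil}(\theta)$. - If, in addition, the composition defining $\mathbf{A}_0$ contains at least one occurrence of the operator $\mathbf{S}\circ\mathbf{R}$ (that is, an $\mathbf{S}$ immediately followed in the composition by an $\mathbf{R}$), then also $\mathrm{Rzeil}(\Phi_{\mathbf{A}}(\theta))=\mathrm{Rzeil}(\theta)$ for every such $\theta$.
   Context: Notation and conventions. - Permutations are in one-line notation, with composition $(\lambda\circ\sigma)(i)=\lambda(\sigma(i))$. - A sequence of distinct integers is identified with the permutation order-isomorphic to it. - $\mathrm{Av}(231)$ (resp. $\mathrm{Av}(132)$) is the set of permutations avoiding $231$ (resp. $132$). Operators. - $\mathbf{S}(\varepsilon)=\varepsilon$ and $\mathbf{S}(\alpha n\beta)=\mathbf{S}(\alpha)\mathbf{S}(\beta)n$, where $n$ is the maximum entry. - $\mathbf{R}$ is reversal. - $\theta$ is sorted by $\mathbf{S}\circ\mathbf{A}$ if $\mathbf{S}(\mathbf{A}(\theta))$ is the identity, equivalently $\mathbf{A}(\theta)\in\mathrm{Av}(231)$. The bijection $P$ and the map $\Phi_{\mathbf{A}}$. - $\alpha\oplus\beta=\alpha(\beta+|\alpha|)$ and $\alpha\ominus\beta=(\alpha+|\beta|)\beta$. - $P:\mathrm{Av}(231)\to\mathrm{Av}(132)$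 is defined by $P(\varepsilon)=\varepsilon$ and $P(\alpha\oplus(1\ominus\beta))=(P(\alpha)\oplus1)\ominus P(\beta)$, using the unique decomposition of nonempty $231$-avoiders as $\alpha\oplus(1\ominus\beta)$ with $\alpha,\beta\in\mathrm{Av}(231)$. - $\lambda_\pi$ is defined by $P(\pi)=\lambda_\pi\circ\pi$. - $\Phi_{\mathbf{A}}(\theta)=\lambda_{\mathbf{A}(\theta)}\circ\theta$. Statistics. For $\pi$ of size $n$: - $\mathrm{zeil}(\pi)=\max\{k: n(n-1)\cdots(n-k+1)\text{ is a subsequence of }\pi\}$; - $\mathrm{Rzeil}(\pi)=\max\{k:(n-k+1)\cdots(n-1)n\text{ is a subsequence of }\pi\}$.
   Formalization: In the second bullet, the occurrence of S∘R in the composition defining A_0 is required after cancelling adjacent R∘R; read literally the claim fails, e.g. A_0 = S∘R∘R and θ = 13452, where Φ_A(θ) = 23451 and Rzeil changes from 3 to 4. *)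

theory Defs
  imports "HOL-Combinatorics.Multiset_Permutations" "HOL-Library.Sublist"
begin

section \<open>Permutations in one-line notation\<close>

text \<open>A permutation of size \<open>n\<close> is the list of its values, an element of
  \<open>permutations_of_set {1..n}\<close>.\<close>

definition is_perm :: "nat list \<Rightarrow> bool" where
  "is_perm \<pi> \<longleftrightarrow> \<pi> \<in> permutations_of_set {1..length \<pi>}"

definition id_perm :: "nat \<Rightarrow> nat list" where
  "id_perm n = [1..<Suc n]"

text \<open>Values and positions count from 1, list indices from 0.\<close>

definition perm_comp :: "nat list \<Rightarrow> nat list \<Rightarrow> nat list" (infixl "\<circ>\<^sub>p" 55) where
  "\<mu> \<circ>\<^sub>p \<sigma> = map (\<lambda>i. \<mu> ! (i - 1)) \<sigma>"

text \<open>The permutation order-isomorphic to a list of distinct numbers.\<close>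

definition standardize :: "nat list \<Rightarrow> nat list" where
  "standardize xs = map (\<lambda>x. card {y \<in> set xs. y \<le> x}) xs"

definition order_iso :: "nat list \<Rightarrow> nat list \<Rightarrow> bool" where
  "order_iso xs ys \<longleftrightarrow> length xs = length ys \<and>
     (\<forall>i<length xs. \<forall>j<length xs. xs ! i < xs ! j \<longleftrightarrow> ys ! i < ys ! j)"

definition Av :: "nat list \<Rightarrow> nat list set" where
  "Av \<tau> = {\<pi>. is_perm \<pi> \<and> \<not> (\<exists>xs. subseq xs \<pi> \<and> order_iso xs \<tau>)}"

definition dsum :: "nat list \<Rightarrow> nat list \<Rightarrow> nat list" (infixr "\<oplus>\<^sub>p" 65) where
  "\<alpha> \<oplus>\<^sub>p \<beta> = \<alpha> @ map (\<lambda>x. x + length \<alpha>) \<beta>"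

definition skew_sum :: "nat list \<Rightarrow> nat list \<Rightarrow> nat list" (infixr "\<ominus>\<^sub>p" 65) where
  "\<alpha> \<ominus>\<^sub>p \<beta> = map (\<lambda>x. x + length \<beta>) \<alpha> @ \<beta>"


section \<open>Splitting a list at its maximum entry\<close>

definition before_max :: "nat list \<Rightarrow> nat list" where
  "before_max xs = takeWhile (\<lambda>x. x \<noteq> Max (set xs)) xs"

definition after_max :: "nat list \<Rightarrow> nat list" where
  "after_max xs = tl (dropWhile (\<lambda>x. x \<noteq> Max (set xs)) xs)"

lemma split_max:
  assumes "xs \<noteq> []"
  shows "xs = before_max xs @ Max (set xs) # after_max xs"
proof -
  let ?d = "dropWhile (\<lambda>x. x \<noteq> Max (set xs)) xs"
  have "Max (set xs) \<in> set xs" using assms by simp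
  then have "?d \<noteq> []" by (auto simp: dropWhile_eq_Nil_conv)
  moreover from hd_dropWhile[OF this] have "hd ?d = Max (set xs)" by simp
  ultimately have "?d = Max (set xs) # tl ?d" by (metis list.collapse)
  then show ?thesis
    unfolding before_max_def after_max_def by (metis takeWhile_dropWhile_id)
qed

lemma length_split_max:
  assumes "xs \<noteq> []"
  shows "length (before_max xs) < length xs" "length (after_max xs) < length xs"
  using arg_cong[OF split_max[OF assms], of length] by simp_all

lemma split_max_append:
  assumes "\<And>x. x \<in> set \<alpha> \<Longrightarrow> x < m" "\<And>x. x \<in> set \<beta> \<Longrightarrow> x < m"
  shows "Max (set (\<alpha> @ m # \<beta>)) = m"
    and "before_max (\<alpha> @ m # \<beta>) = \<alpha>" and "after_max (\<alpha> @ m # \<beta>) = \<beta>"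
proof -
  show M: "Max (set (\<alpha> @ m # \<beta>)) = m"
    by (rule Max_eqI) (auto dest: assms less_imp_le)
  have ne: "\<And>x. x \<in> set \<alpha> \<Longrightarrow> x \<noteq> m" using assms(1) by blast
  show "before_max (\<alpha> @ m # \<beta>) = \<alpha>"
    unfolding before_max_def M using ne by (subst takeWhile_append2) auto
  show "after_max (\<alpha> @ m # \<beta>) = \<beta>"
    unfolding after_max_def M using ne by (subst dropWhile_append2) auto
qed


section \<open>Stack sorting and compositions of operators\<close>

function stack_sort :: "nat list \<Rightarrow> nat list" where
  "stack_sort xs = (if xs = [] then [] else
     stack_sort (before_max xs) @ stack_sort (after_max xs) @ [Max (set xs)])"
  by pat_completeness auto
termination
  by (relation "measure length") (simp_all add: length_split_max)

declare stack_sort.simps [simp del]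

lemma stack_sort_Nil: "stack_sort [] = []"
  by (simp add: stack_sort.simps)

lemma stack_sort_append:
  assumes "\<And>x. x \<in> set \<alpha> \<Longrightarrow> x < n" "\<And>x. x \<in> set \<beta> \<Longrightarrow> x < n"
  shows "stack_sort (\<alpha> @ n # \<beta>) = stack_sort \<alpha> @ stack_sort \<beta> @ [n]"
  by (subst stack_sort.simps) (simp add: split_max_append[OF assms] del: set_append list.set)

definition sorted_by :: "(nat list \<Rightarrow> nat list) \<Rightarrow> nat list \<Rightarrow> bool" where
  "sorted_by F \<theta> \<longleftrightarrow> F \<theta> = id_perm (length \<theta>)"

text \<open>A composition of operators is a word, written in the order of the composition:
  \<open>[Srt, Rvs]\<close> stands for \<open>S \<circ> R\<close>, which applies \<open>R\<close> first.\<close>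

datatype sr_op = Srt | Rvs

fun op_fun :: "sr_op \<Rightarrow> nat list \<Rightarrow> nat list" where
  "op_fun Srt = stack_sort"
| "op_fun Rvs = rev"

definition compose :: "sr_op list \<Rightarrow> nat list \<Rightarrow> nat list" where
  "compose w = foldr (\<lambda>f g. op_fun f \<circ> g) w id"

text \<open>Whether a word contains \<open>S \<circ> R\<close> has to be read after cancelling \<open>R \<circ> R = id\<close>:
  the word \<open>S \<circ> R \<circ> R\<close> denotes \<open>S\<close>, and it is not meant to count as containing \<open>S \<circ> R\<close>
  (for \<open>A = S \<circ> R \<circ> R \<circ> S\<close> the map \<open>\<Phi>\<^sub>A\<close> sends 13452, with \<open>Rzeil\<close> equal to 3, to
  23451, with \<open>Rzeil\<close> equal to 4).\<close>

fun cancel_RR :: "sr_op list \<Rightarrow> sr_op list" where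
  "cancel_RR [] = []"
| "cancel_RR (Srt # w) = Srt # cancel_RR w"
| "cancel_RR (Rvs # w) = (case cancel_RR w of Rvs # v \<Rightarrow> v | v \<Rightarrow> Rvs # v)"

definition contains_SR :: "sr_op list \<Rightarrow> bool" where
  "contains_SR w \<longleftrightarrow> sublist [Srt, Rvs] (cancel_RR w)"

lemma compose_simps:
  "compose [] = id" "compose (f # w) = op_fun f \<circ> compose w"
  by (simp_all add: compose_def)

lemma compose_cancel_RR: "compose (cancel_RR w) = compose w"
proof (induction w rule: cancel_RR.induct)
  case (3 w)
  then show ?case
    by (auto simp: compose_simps fun_eq_iff split: list.split sr_op.split) (metis rev_rev_ident)+
qed (simp_all add: compose_simps)

lemma not_sublist_cancel_RR: "\<not> sublist [Rvs, Rvs] (cancel_RR w)"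
  by (induction w rule: cancel_RR.induct)
     (auto simp: sublist_Cons_right split: list.splits sr_op.splits)

lemma contains_SR_reduced:
  assumes "\<not> sublist [Rvs, Rvs] w"
  shows "contains_SR w \<longleftrightarrow> sublist [Srt, Rvs] w"
proof -
  have "cancel_RR w = w" using assms
    by (induction w rule: cancel_RR.induct)
       (auto simp: sublist_Cons_right split: list.splits sr_op.splits)
  then show ?thesis by (simp add: contains_SR_def)
qed


section \<open>The bijection \<open>P\<close> and the maps \<open>\<Phi>\<^sub>A\<close>\<close>

text \<open>A nonempty 231-avoider \<open>\<alpha> \<oplus> (1 \<ominus> \<beta>)\<close> is \<open>\<alpha>\<close>, its maximum, and a shifted copy
  of \<open>\<beta>\<close>. Outside \<open>Av [2, 3, 1]\<close> the values of \<open>bij_P\<close> are irrelevant.\<close>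

function bij_P :: "nat list \<Rightarrow> nat list" where
  "bij_P xs = (if xs = [] then [] else
     (bij_P (standardize (before_max xs)) \<oplus>\<^sub>p [1]) \<ominus>\<^sub>p bij_P (standardize (after_max xs)))"
  by pat_completeness auto
termination
  by (relation "measure length") (simp_all add: length_split_max standardize_def)

declare bij_P.simps [simp del]

lemma is_perm_iff: "is_perm \<pi> \<longleftrightarrow> set \<pi> = {1..length \<pi>} \<and> distinct \<pi>"
  by (simp add: is_perm_def permutations_of_set_def)

lemma standardize_shift:
  assumes "is_perm \<alpha>"
  shows "standardize (map (\<lambda>x. x + k) \<alpha>) = \<alpha>"
proof -
  have "card {y \<in> (\<lambda>x. x + k) ` set \<alpha>. y \<le> x + k} = x" if "x \<in> set \<alpha>" for x
  proof -
    have "{y \<in> (\<lambda>x. x + k) ` set \<alpha>. y \<le> x + k} = (\<lambda>x. x + k) ` {1..x}"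
      using that assms by (fastforce simp: is_perm_iff)
    then show ?thesis by (simp add: card_image)
  qed
  then show ?thesis by (auto simp: standardize_def intro!: map_idI)
qed

lemma standardize_perm: "is_perm \<alpha> \<Longrightarrow> standardize \<alpha> = \<alpha>"
  using standardize_shift[of \<alpha> 0] by simp

lemma dsum_skew_eq:
  "\<alpha> \<oplus>\<^sub>p [1] \<ominus>\<^sub>p \<beta> = \<alpha> @ (length \<alpha> + length \<beta> + 1) # map (\<lambda>x. x + length \<alpha>) \<beta>"
  by (simp add: dsum_def skew_sum_def)

lemma bij_P_Nil: "bij_P [] = []"
  by (simp add: bij_P.simps)

theorem bij_P_decomp:
  assumes "is_perm \<alpha>" "is_perm \<beta>"
  shows "bij_P (\<alpha> \<oplus>\<^sub>p ([1] \<ominus>\<^sub>p \<beta>)) = (bij_P \<alpha> \<oplus>\<^sub>p [1]) \<ominus>\<^sub>p bij_P \<beta>"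
proof -
  let ?m = "length \<alpha> + length \<beta> + 1" and ?\<beta> = "map (\<lambda>x. x + length \<alpha>) \<beta>"
  have a: "\<And>x. x \<in> set \<alpha> \<Longrightarrow> x < ?m" and b: "\<And>x. x \<in> set ?\<beta> \<Longrightarrow> x < ?m"
    using assms by (auto simp: is_perm_iff)
  have "bij_P (\<alpha> @ ?m # ?\<beta>) = (bij_P \<alpha> \<oplus>\<^sub>p [1]) \<ominus>\<^sub>p bij_P \<beta>"
    by (subst bij_P.simps)
       (simp only: split_max_append(2,3)[of \<alpha> ?m ?\<beta>, OF a b]
         standardize_perm[OF assms(1)] standardize_shift[OF assms(2)] append_is_Nil_conv list.distinct
         simp_thms if_False)
  then show ?thesis by (simp only: dsum_skew_eq)
qed

lemma Av_231_decomp: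
  assumes "\<pi> \<in> Av [2, 3, 1]" "\<pi> \<noteq> []"
  shows "\<exists>\<alpha>\<in>Av [2, 3, 1]. \<exists>\<beta>\<in>Av [2, 3, 1]. \<pi> = \<alpha> \<oplus>\<^sub>p ([1] \<ominus>\<^sub>p \<beta>)"
proof -
  obtain a m c where eq: "\<pi> = a @ m # c" and Max: "m = Max (set \<pi>)"
    using split_max[OF assms(2)] by blast
  let ?k = "length a" and ?l = "length c"
  have perm: "is_perm \<pi>" and av: "\<And>xs. subseq xs \<pi> \<Longrightarrow> \<not> order_iso xs [2, 3, 1]"
    using assms(1) by (auto simp: Av_def)
  have len: "length \<pi> = ?k + ?l + 1" by (simp add: eq)
  have dist: "distinct (a @ m # c)" using perm eq by (simp add: is_perm_iff)
  have set: "set a \<union> {m} \<union> set c = {1..?k + ?l + 1}"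
    using perm len arg_cong[OF eq, of set] by (auto simp: is_perm_iff)
  have m: "m = ?k + ?l + 1"
    unfolding Max using perm len by (intro Max_eqI) (auto simp: is_perm_iff)
  have lt: "x < y" if "x \<in> set a" "y \<in> set c" for x y
  proof (rule ccontr)
    assume "\<not> x < y"
    moreover have "x \<noteq> y" using dist that by auto
    ultimately have yx: "y < x" by simp
    have "x \<noteq> m" "x \<le> m" using dist that perm eq m set by auto
    then have "order_iso [x, m, y] [2, 3, 1]"
      using yx by (auto simp: order_iso_def less_Suc_eq nth_Cons split: nat.split)
    moreover have "subseq ([x] @ [m] @ [y]) (a @ [m] @ c)"
      by (intro list_emb_append_mono) (use that in \<open>auto simp: subseq_singleton_left\<close>)
    ultimately show False using av[of "[x, m, y]"] eq by simp
  qed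
  have ab: "set a \<union> set c = {1..?k + ?l}"
  proof -
    have "set a \<union> set c = {1..?k + ?l + 1} - {m}" using set dist by auto
    also have "\<dots> = {1..?k + ?l}" unfolding m by auto
    finally show ?thesis .
  qed
  have ca: "card (set a) = ?k" using dist by (simp add: distinct_card)
  have cb: "card (set c) = ?l" using dist by (simp add: distinct_card)
  have seta: "set a = {1..?k}"
  proof -
    have "x \<le> ?k" if x: "x \<in> set a" for x
    proof -
      have "y \<in> set a" if "y \<in> {1..x}" for y
      proof -
        have "x \<in> {1..?k + ?l}" using x ab by blast
        then have "y \<in> set a \<union> set c" using that unfolding ab by simp
        moreover have "y \<notin> set c" using lt[OF x] that by fastforce
        ultimately show ?thesis by blast
      qed
      then have "{1..x} \<subseteq> set a" by blast
      then have "card {1..x} \<le> card (set a)" by (intro card_mono) auto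
      then show ?thesis using ca by simp
    qed
    then have "set a \<subseteq> {1..?k}" using ab by auto
    then show ?thesis using ca by (intro card_subset_eq) auto
  qed
  have setb: "set c = {?k + 1..?k + ?l}"
  proof -
    have "set c = {1..?k + ?l} - {1..?k}" using ab seta dist by auto
    also have "\<dots> = {?k + 1..?k + ?l}" by auto
    finally show ?thesis .
  qed
  define b where "b = map (\<lambda>x. x - ?k) c"
  have bk: "map (\<lambda>x. x + ?k) b = c"
    unfolding b_def using setb by (auto simp: o_def intro!: map_idI)
  have perma: "is_perm a" using seta dist by (simp add: is_perm_iff)
  have permb: "is_perm b"
  proof -
    have "set b = (\<lambda>x. x - ?k) ` {?k + 1..?k + ?l}" using setb by (simp add: b_def)
    also have "{?k + 1..?k + ?l} = (\<lambda>x. x + ?k) ` {1..?l}"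
      by (simp add: image_add_atLeastAtMost' add.commute)
    also have "(\<lambda>x. x - ?k) ` \<dots> = {1..?l}"
      by (simp add: image_image del: image_add_atLeastAtMost')
    finally have "set b = {1..?l}" .
    moreover have "distinct b" using dist bk by (metis distinct_append distinct.simps(2) distinct_map)
    ultimately show ?thesis by (simp add: is_perm_iff b_def)
  qed
  have ava: "a \<in> Av [2, 3, 1]"
  proof -
    have "subseq xs \<pi>" if "subseq xs a" for xs
      using list_emb_append_mono[OF that list_emb_Nil, of "m # c"] eq by simp
    then show ?thesis using perma av by (auto simp: Av_def)
  qed
  have avb: "b \<in> Av [2, 3, 1]"
  proof -
    have False if xs: "subseq xs b" "order_iso xs [2, 3, 1]" for xs
    proof -
      have "subseq (map (\<lambda>x. x + ?k) xs) c" using subseq_map[OF xs(1)] bk by metis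
      then have "subseq (map (\<lambda>x. x + ?k) xs) (a @ m # c)"
        by (metis append_Cons append_Nil append_assoc list_emb_append2)
      moreover have "order_iso (map (\<lambda>x. x + ?k) xs) [2, 3, 1]"
        using xs(2) by (simp add: order_iso_def)
      ultimately show False using av eq by metis
    qed
    then show ?thesis using permb by (auto simp: Av_def)
  qed
  have "\<pi> = a \<oplus>\<^sub>p ([1] \<ominus>\<^sub>p b)"
  proof -
    have "a \<oplus>\<^sub>p ([1] \<ominus>\<^sub>p b) = a @ (?k + length b + 1) # map (\<lambda>x. x + ?k) b"
      by (rule dsum_skew_eq)
    also have "\<dots> = a @ m # c" using bk m by (simp add: b_def)
    finally show ?thesis using eq by simp
  qed
  then show ?thesis using ava avb by blast
qed

lemma is_perm_standardize:
  assumes "distinct xs"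
  shows "is_perm (standardize xs)"
proof -
  let ?f = "\<lambda>x. card {y \<in> set xs. y \<le> x}"
  have "strict_mono_on (set xs) ?f"
    by (intro strict_mono_onI psubset_card_mono psubsetI)
       (auto simp: set_eq_iff not_le[symmetric])
  then have inj: "inj_on ?f (set xs)" by (rule strict_mono_on_imp_inj_on)
  have "?f x \<in> {1..length xs}" if "x \<in> set xs" for x
  proof -
    have "{y \<in> set xs. y \<le> x} \<noteq> {}" using that by blast
    then have "0 < ?f x" by (simp add: card_gt_0_iff)
    moreover have "?f x \<le> card (set xs)" by (intro card_mono) auto
    ultimately show ?thesis using card_length[of xs] by auto
  qed
  then have "?f ` set xs \<subseteq> {1..length xs}" by blast
  moreover have "card (?f ` set xs) = card {1..length xs}"
    using inj assms by (simp add: card_image distinct_card)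
  ultimately have "?f ` set xs = {1..length xs}" by (intro card_subset_eq) auto
  then show ?thesis using inj assms by (simp add: is_perm_iff standardize_def distinct_map)
qed

lemma is_perm_dsum_skew:
  assumes "is_perm \<alpha>" "is_perm \<beta>"
  shows "is_perm ((\<alpha> \<oplus>\<^sub>p [1]) \<ominus>\<^sub>p \<beta>)"
proof -
  let ?g = "(\<alpha> \<oplus>\<^sub>p [1]) \<ominus>\<^sub>p \<beta>"
  have len: "length ?g = length \<alpha> + 1 + length \<beta>" by (simp add: dsum_def skew_sum_def)
  have "set (\<alpha> \<oplus>\<^sub>p [1]) = {1..length \<alpha> + 1}"
    using assms by (auto simp: dsum_def is_perm_iff)
  then have "set ?g = (\<lambda>x. x + length \<beta>) ` {1..length \<alpha> + 1} \<union> {1..length \<beta>}"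
    using assms by (simp add: skew_sum_def is_perm_iff)
  also have "\<dots> = {1..length ?g}" unfolding image_add_atLeastAtMost' len by auto
  finally have "set ?g = {1..length ?g}" .
  moreover from this have "distinct ?g" by (metis card_atLeastAtMost card_distinct diff_Suc_1)
  ultimately show ?thesis by (simp add: is_perm_iff)
qed

lemma length_bij_P: "length (bij_P xs) = length xs"
proof (induction xs rule: bij_P.induct)
  case (1 xs)
  show ?case
  proof (cases "xs = []")
    case False
    have "length (bij_P xs) = length (before_max xs) + 1 + length (after_max xs)"
      using 1[OF False] False
      by (subst bij_P.simps) (simp add: dsum_def skew_sum_def standardize_def)
    also have "\<dots> = length xs"
      using arg_cong[OF split_max[OF False], of length] by simp
    finally show ?thesis .
  qed (simp add: bij_P_Nil)
qed

lemma is_perm_bij_P: "distinct xs \<Longrightarrow> is_perm (bij_P xs)"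
proof (induction xs rule: bij_P.induct)
  case (1 xs)
  show ?case
  proof (cases "xs = []")
    case False
    have "distinct (before_max xs @ Max (set xs) # after_max xs)"
      using "1.prems" split_max[OF False] by simp
    then have "is_perm (standardize (before_max xs))" "is_perm (standardize (after_max xs))"
      by (simp_all add: is_perm_standardize)
    moreover from this
    have "distinct (standardize (before_max xs))" "distinct (standardize (after_max xs))"
      by (simp_all add: is_perm_iff)
    ultimately show ?thesis
      using "1.IH"[OF False] False
      by (subst bij_P.simps) (simp add: is_perm_dsum_skew del: One_nat_def)
  qed (simp add: bij_P_Nil is_perm_iff)
qed

lemma perm_left_quotient:
  assumes \<pi>: "is_perm \<pi>" and \<rho>: "is_perm \<rho>" and len: "length \<rho> = length \<pi>"
  shows "\<exists>!\<mu>. is_perm \<mu> \<and> length \<mu> = length \<pi> \<and> \<rho> = \<mu> \<circ>\<^sub>p \<pi>"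
proof (rule ex_ex1I)
  let ?n = "length \<pi>"
  define f where "f v = the (map_of (zip \<pi> \<rho>) v)" for v
  define \<mu> where "\<mu> = map f [1..<Suc ?n]"
  have "f (\<pi> ! i) = \<rho> ! i" if "i < ?n" for i
    using that \<pi> len by (simp add: f_def map_of_zip_nth is_perm_iff)
  then have \<rho>f: "\<rho> = map f \<pi>" using len by (intro nth_equalityI) auto
  have "set \<mu> = f ` set \<pi>" using \<pi> by (auto simp: \<mu>_def is_perm_iff)
  also have "\<dots> = set \<rho>" by (subst \<rho>f) simp
  finally have "set \<mu> = {1..length \<mu>}" using \<rho> len by (simp add: is_perm_iff \<mu>_def del: upt_Suc)
  moreover from this have "distinct \<mu>" by (metis card_atLeastAtMost card_distinct diff_Suc_1)
  moreover have "\<mu> ! (v - 1) = f v" if "v \<in> set \<pi>" for v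
  proof -
    have "1 \<le> v" "v \<le> ?n" using that \<pi> by (auto simp: is_perm_iff)
    then show ?thesis by (simp add: \<mu>_def nth_map del: upt_Suc)
  qed
  then have "\<mu> \<circ>\<^sub>p \<pi> = \<rho>" by (simp add: perm_comp_def \<rho>f)
  ultimately show "\<exists>\<mu>. is_perm \<mu> \<and> length \<mu> = ?n \<and> \<rho> = \<mu> \<circ>\<^sub>p \<pi>"
    by (intro exI[of _ \<mu>]) (auto simp: is_perm_iff \<mu>_def simp del: upt_Suc)
next
  fix \<mu> \<nu>
  assume \<mu>: "is_perm \<mu> \<and> length \<mu> = length \<pi> \<and> \<rho> = \<mu> \<circ>\<^sub>p \<pi>"
    and \<nu>: "is_perm \<nu> \<and> length \<nu> = length \<pi> \<and> \<rho> = \<nu> \<circ>\<^sub>p \<pi>"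
  show "\<mu> = \<nu>"
  proof (rule nth_equalityI)
    fix i assume "i < length \<mu>"
    then have "Suc i \<in> set \<pi>" using \<mu> \<pi> by (auto simp: is_perm_iff)
    moreover have "map (\<lambda>i. \<mu> ! (i - 1)) \<pi> = map (\<lambda>i. \<nu> ! (i - 1)) \<pi>"
      using \<mu> \<nu> by (simp add: perm_comp_def)
    ultimately have "\<mu> ! (Suc i - 1) = \<nu> ! (Suc i - 1)" by (metis (no_types, lifting) map_eq_conv)
    then show "\<mu> ! i = \<nu> ! i" by simp
  qed (use \<mu> \<nu> in simp)
qed

text \<open>The permutation \<open>\<lambda>\<^sub>\<pi>\<close> with \<open>P \<pi> = \<lambda>\<^sub>\<pi> \<circ> \<pi>\<close>.\<close>

definition lam :: "nat list \<Rightarrow> nat list" where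
  "lam \<pi> = (THE \<mu>. is_perm \<mu> \<and> length \<mu> = length \<pi> \<and> bij_P \<pi> = \<mu> \<circ>\<^sub>p \<pi>)"

lemma lam_spec:
  assumes "is_perm \<pi>"
  shows "is_perm (lam \<pi>)" "length (lam \<pi>) = length \<pi>" "bij_P \<pi> = lam \<pi> \<circ>\<^sub>p \<pi>"
proof -
  have "distinct \<pi>" using assms by (simp add: is_perm_iff)
  from theI'[OF perm_left_quotient[OF assms is_perm_bij_P[OF this] length_bij_P]]
  show "is_perm (lam \<pi>)" "length (lam \<pi>) = length \<pi>" "bij_P \<pi> = lam \<pi> \<circ>\<^sub>p \<pi>"
    unfolding lam_def by blast+
qed

definition Phi :: "(nat list \<Rightarrow> nat list) \<Rightarrow> nat list \<Rightarrow> nat list" where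
  "Phi A \<theta> = lam (A \<theta>) \<circ>\<^sub>p \<theta>"


section \<open>Statistics\<close>

definition zeil :: "nat list \<Rightarrow> nat" where
  "zeil \<pi> = Max {k. k \<le> length \<pi> \<and> subseq (rev [Suc (length \<pi>) - k..<Suc (length \<pi>)]) \<pi>}"

definition Rzeil :: "nat list \<Rightarrow> nat" where
  "Rzeil \<pi> = Max {k. k \<le> length \<pi> \<and> subseq [Suc (length \<pi>) - k..<Suc (length \<pi>)] \<pi>}"

end

theory Submission
  imports Defs
begin

text \<open>Say that two entries of a sequence are separated if a larger entry lies between them. The
  permutation \<open>\<lambda>\<^sub>\<pi>\<close> inverts only pairs that are separated in \<open>\<pi>\<close>, and passing from \<open>S(\<sigma>)\<close> or \<open>R(\<sigma>)\<close>
  back to \<open>\<sigma>\<close> preserves separation; hence a pair inverted by \<open>\<lambda>\<close> is separated in all the intermediate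
  results of \<open>A\<close>. If \<open>n, n-1, \<dots>, n-k+1\<close> is a subsequence of \<open>\<sigma>\<close>, then \<open>S(\<sigma>)\<close> ends with
  \<open>n-k+1, \<dots>, n\<close>, so no pair with larger entry at least \<open>n-k\<close> is separated in \<open>S(\<sigma>)\<close>, and \<open>\<lambda>\<close> fixes
  \<open>n-k, \<dots>, n\<close>. For \<open>zeil\<close> take \<open>\<sigma> = \<theta>\<close>. For \<open>Rzeil\<close> take \<open>\<sigma> = R(S\<^sup>j(\<theta>))\<close>
  for the innermost \<open>S \<circ> R\<close> in \<open>A\<^sub>0\<close>, using that \<open>S\<close> keeps
  increasing subsequences.\<close>

section \<open>Stack sorting and separated pairs\<close>

text \<open>The common recursion of \<open>stack_sort\<close> and \<open>bij_P\<close>, turned into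
  an induction rule. Distinctness makes the comparisons with the maximum strict.\<close>

lemma distinct_max_induct [consumes 1, case_names Nil split]:
  fixes xs :: "nat list"
  assumes "distinct xs" and "P []"
    and "\<And>a m b. distinct (a @ m # b) \<Longrightarrow> (\<And>x. x \<in> set a \<Longrightarrow> x < m) \<Longrightarrow> (\<And>x. x \<in> set b \<Longrightarrow> x < m)
      \<Longrightarrow> P a \<Longrightarrow> P b \<Longrightarrow> P (a @ m # b)"
  shows "P xs"
  using assms(1)
proof (induction xs rule: length_induct)
  case (1 xs)
  show ?case
  proof (cases "xs = []")
    case False
    define a m b where d: "a = before_max xs" "m = Max (set xs)" "b = after_max xs"
    have xs: "xs = a @ m # b" using split_max[OF False] by (simp add: d)
    have dist: "distinct (a @ m # b)" using 1(2) xs by simp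
    have le: "x \<le> m" if "x \<in> set xs" for x using that by (simp add: d)
    have "x < m" if "x \<in> set a \<union> set b" for x
    proof -
      have "x \<noteq> m" using that dist by auto
      moreover have "x \<le> m" using that xs by (intro le) auto
      ultimately show ?thesis by simp
    qed
    moreover have "P a" "P b" using 1(1) xs dist by auto
    ultimately show ?thesis using assms(3)[of a m b] dist unfolding xs by blast
  qed (simp add: assms(2))
qed

section \<open>The operators as rearrangements\<close>

lemma mset_stack_sort: "mset (stack_sort xs) = mset xs"
proof (induction xs rule: stack_sort.induct)
  case (1 xs)
  show ?case
  proof (cases "xs = []")
    case False
    have "mset (stack_sort xs) = mset (before_max xs @ Max (set xs) # after_max xs)"
      using 1[OF False] False by (subst stack_sort.simps) simp
    then show ?thesis using split_max[OF False] by simp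
  qed (simp add: stack_sort_Nil)
qed

lemma set_stack_sort [simp]: "set (stack_sort xs) = set xs"
  and distinct_stack_sort [simp]: "distinct (stack_sort xs) = distinct xs"
  using mset_stack_sort mset_eq_setD mset_eq_imp_distinct_iff by blast+

lemma mset_compose: "mset (compose w xs) = mset xs"
proof (induction w)
  case (Cons f w)
  then show ?case by (cases f) (simp_all add: compose_simps mset_stack_sort)
qed (simp add: compose_simps)

lemma compose_append: "compose (u @ v) = compose u \<circ> compose v"
  by (induction u) (simp_all add: compose_simps o_assoc)

lemma is_perm_mset_cong:
  assumes "mset xs = mset ys" shows "is_perm xs = is_perm ys"
  using mset_eq_setD[OF assms] mset_eq_length[OF assms] mset_eq_imp_distinct_iff[OF assms]
  by (simp add: is_perm_iff)

section \<open>Separation and its behaviour under the operators\<close>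

definition separated :: "nat list \<Rightarrow> nat \<Rightarrow> nat \<Rightarrow> bool" where
  "separated xs u v \<longleftrightarrow> (\<exists>w. u < w \<and> v < w \<and> (subseq [u, w, v] xs \<or> subseq [v, w, u] xs))"

lemma separated_sym: "separated xs u v = separated xs v u"
  by (auto simp: separated_def)

lemma separated_mono: "separated xs u v \<Longrightarrow> subseq xs ys \<Longrightarrow> separated ys u v"
  unfolding separated_def by (meson subseq_order.order_trans)

lemma subseq_set_subset: "subseq xs ys \<Longrightarrow> set xs \<subseteq> set ys"
  by (metis notin_set_nthsI subseq_conv_nths subsetI)

lemma subseq_rev: "subseq (rev xs) (rev ys) = subseq xs ys"
proof -
  have "subseq (rev xs) (rev ys)" if "subseq xs ys" for xs ys :: "'a list"
    using that by induction (auto intro: list_emb_append_mono)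
  from this[of xs ys] this[of "rev xs" "rev ys"] show ?thesis by auto
qed

lemma separated_rev: "separated (rev xs) u v = separated xs u v"
proof -
  have "subseq [a, b, c] (rev xs) = subseq [c, b, a] xs" for a b c
    using subseq_rev[of "[c, b, a]" xs] by simp
  then show ?thesis by (auto simp: separated_def)
qed

lemma separated_splitI:
  assumes "u \<in> set a" "v \<in> set b" "u < m" "v < m"
  shows "separated (a @ m # b) u v"
proof -
  have "subseq ([u] @ [m] @ [v]) (a @ [m] @ b)"
    by (intro list_emb_append_mono) (use assms in \<open>auto simp: subseq_singleton_left\<close>)
  then show ?thesis using assms by (auto simp: separated_def)
qed

lemma subseq_Cons_append_right:
  assumes "subseq (p # zs) (a @ b)" "p \<notin> set a"
  shows "subseq (p # zs) b"
  using assms by (induction a) auto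

lemma subseq_snoc_append_left:
  assumes "subseq (zs @ [q]) (a @ b)" "q \<notin> set b"
  shows "subseq (zs @ [q]) a"
proof -
  have "subseq (q # rev zs) (rev b @ rev a)"
    using assms(1) subseq_rev[of "zs @ [q]" "a @ b"] by simp
  then have "subseq (rev (zs @ [q])) (rev a)"
    using assms(2) subseq_Cons_append_right[of q "rev zs" "rev b" "rev a"] by simp
  then show ?thesis by (simp only: subseq_rev)
qed

text \<open>A separated pair of S(a) S(b) m lies, together with its separator, within S(a) or within
  S(b), or else has its left entry from a and its right entry from b. In the last case m, which
  stands between a and b in \<open>xs\<close>, serves as the new separator.\<close>

lemma separated_stack_sort:
  assumes "distinct xs" "separated (stack_sort xs) u v"
  shows "separated xs u v"
proof -
  have "separated xs p q" if "subseq [p, w, q] (stack_sort xs)" "p < w" "q < w" for p w q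
    using assms(1) that
  proof (induction xs rule: distinct_max_induct)
    case Nil
    then show ?case by (simp add: stack_sort_Nil)
  next
    case (split a m b)
    have S: "stack_sort (a @ m # b) = (stack_sort a @ stack_sort b) @ [m]"
      using split.hyps by (simp add: stack_sort_append)
    have "w \<in> set (stack_sort (a @ m # b))"
      using split.prems(1) by (auto dest!: subseq_set_subset)
    then have "w \<le> m" using split.hyps by (auto dest: less_imp_le)
    then have lt: "p < m" "q < m" using split.prems by auto
    have sub: "subseq [p, w, q] (stack_sort a @ stack_sort b)"
      using subseq_snoc_append_left[of "[p, w]" q _ "[m]"] split.prems(1) lt unfolding S by simp
    then have pq: "p \<in> set a \<union> set b" "q \<in> set a \<union> set b"
      by (auto dest!: subseq_set_subset)
    have subs: "subseq a (a @ m # b)" "subseq b (a @ m # b)" by auto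
    show ?case
    proof (cases "q \<in> set b")
      case True
      show ?thesis
      proof (cases "p \<in> set b")
        case True
        then have "subseq [p, w, q] (stack_sort b)"
          using subseq_Cons_append_right[OF sub] split.hyps(1) by auto
        then show ?thesis using split.IH(2) split.prems subs separated_mono by blast
      qed (use \<open>q \<in> set b\<close> pq lt in \<open>auto intro: separated_splitI\<close>)
    next
      case False
      then have "subseq [p, w, q] (stack_sort a)"
        using subseq_snoc_append_left[of "[p, w]" q] sub by simp
      then show ?thesis using split.IH(1) split.prems subs separated_mono by blast
    qed
  qed
  then show ?thesis using assms(2) separated_sym unfolding separated_def[of "stack_sort xs"]
    by blast
qed

lemma separated_compose:
  assumes "distinct xs" "separated (compose w xs) u v"
  shows "separated xs u v"
  using assms(2)
proof (induction w)
  case (Cons f w)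
  have "distinct (compose w xs)"
    using assms(1) mset_compose mset_eq_imp_distinct_iff by blast
  then show ?case using Cons
    by (cases f) (auto simp: compose_simps separated_rev dest: separated_stack_sort)
qed (simp add: compose_simps)

section \<open>Monotone subsequences under sorting\<close>

text \<open>In passing from a m b to S(a) S(b) m only m moves to the right, past b; an increasing
  subsequence through m has nothing after it.\<close>

lemma subseq_stack_sort:
  assumes "distinct xs" "sorted_wrt (<) zs" "subseq zs xs"
  shows "subseq zs (stack_sort xs)"
  using assms
proof (induction xs arbitrary: zs rule: distinct_max_induct)
  case (split a m b)
  have S: "stack_sort (a @ m # b) = stack_sort a @ stack_sort b @ [m]"
    using split.hyps by (simp add: stack_sort_append)
  obtain z1 z2 where z: "zs = z1 @ z2" "subseq z1 a" "subseq z2 (m # b)"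
    using split.prems(2) unfolding subseq_append_iff by blast
  have 1: "subseq z1 (stack_sort a)"
    using split.IH(1)[of z1] split.prems(1) z by (simp add: sorted_wrt_append)
  have "subseq z2 (stack_sort b @ [m])"
  proof (cases "z2 \<noteq> [] \<and> hd z2 = m")
    case True
    then obtain z3 where z3: "z2 = m # z3" by (metis list.collapse)
    then have "set z3 \<subseteq> set b" using z(3) by (auto dest!: subseq_set_subset)
    moreover have "\<forall>x\<in>set z3. m < x" using split.prems(1) z z3 by (simp add: sorted_wrt_append)
    ultimately have "z3 = []" using split.hyps(3) by (cases z3) (auto dest: less_asym)
    then show ?thesis using z3 by (simp add: subseq_singleton_left)
  next
    case False
    then have "subseq z2 b" using z(3) by (cases z2) (auto split: if_splits)
    then have "subseq z2 (stack_sort b)"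
      using split.IH(2)[of z2] split.prems(1) z by (simp add: sorted_wrt_append)
    then show ?thesis by auto
  qed
  then show ?case unfolding S z(1) using 1 by (rule list_emb_append_mono[rotated])
qed (simp add: stack_sort_Nil)

text \<open>The hypotheses make \<open>ds\<close> the list of the largest entries in decreasing
  order. Its head d is the maximum, so the rest lies in the part b after d, and S(xs) = S(a) S(b) d
  reduces the claim to b.\<close>

lemma suffix_stack_sort:
  assumes "distinct xs" "sorted_wrt (>) ds" "subseq ds xs"
    and "\<And>x d. x \<in> set xs - set ds \<Longrightarrow> d \<in> set ds \<Longrightarrow> x < d"
  shows "suffix (rev ds) (stack_sort xs)"
  using assms
proof (induction ds arbitrary: xs)
  case (Cons d ds)
  obtain a b where xs: "xs = a @ d # b" and sub: "subseq ds b"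
    using Cons.prems(3) by (auto dest: list_emb_ConsD)
  have lt: "x < d" if "x \<in> set a \<union> set b" for x
  proof (cases "x \<in> set ds")
    case True
    then show ?thesis using Cons.prems(2) by simp
  next
    case False
    then show ?thesis using Cons.prems(1,4) that xs by auto
  qed
  have "suffix (rev ds) (stack_sort b)"
    using Cons.prems xs sub by (intro Cons.IH) auto
  moreover have "stack_sort xs = stack_sort a @ stack_sort b @ [d]"
    using lt by (simp add: xs stack_sort_append)
  ultimately show ?case by (auto simp: suffix_def)
qed simp

text \<open>A separator \<open>w\<close> exceeds \<open>v\<close>, so it lies in the sorted tail
  \<open>ds\<close>; the entry after it in the triple is then at least \<open>w\<close>, whereas a
  separator exceeds both entries of its pair.\<close>

lemma not_separated_sorted_suffix:
  assumes "distinct xs" "xs = ys @ ds" "sorted ds" and "\<And>w. w \<in> set xs \<Longrightarrow> v < w \<Longrightarrow> w \<in> set ds"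
  shows "\<not> separated xs u v"
proof -
  have "w \<le> q" if sub: "subseq [p, w, q] (ys @ ds)" and "v < w" for p w q
  proof -
    have "w \<in> set xs" using sub assms(2) by (auto dest!: subseq_set_subset)
    then have "w \<in> set ds" using assms(4) \<open>v < w\<close> by blast
    moreover have "subseq [w, q] (ys @ ds)" using sub by (rule subseq_Cons')
    ultimately have "subseq [w, q] ds"
      using assms(1,2) by (intro subseq_Cons_append_right[of w "[q]" ys ds]) auto
    then have "sorted [w, q]" using assms(3) sorted_nths subseq_conv_nths by metis
    then show ?thesis by simp
  qed
  then show ?thesis using assms(2) by (fastforce simp: separated_def)
qed


section \<open>Pairs inverted by the bijection\<close>

text \<open>Standardization is a strictly increasing relabelling, so it can be absorbed into the map
  \<open>f\<close> of the induction below.\<close>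

lemma standardize_strict_mono_on:
  obtains h where "standardize xs = map h xs" "strict_mono_on (set xs) h"
proof
  show "standardize xs = map (\<lambda>x. card {y \<in> set xs. y \<le> x}) xs" by (simp add: standardize_def)
  show "strict_mono_on (set xs) (\<lambda>x. card {y \<in> set xs. y \<le> x})"
    by (intro strict_mono_onI psubset_card_mono psubsetI)
       (auto simp: set_eq_iff not_le[symmetric])
qed

text \<open>The map \<open>f\<close> makes the induction go through the standardizations in \<^const>\<open>bij_P\<close>.\<close>

lemma bij_P_map_inversions:
  assumes "distinct xs" "sorted (stack_sort xs)" "strict_mono_on (set xs) f"
  shows "\<exists>g. bij_P (map f xs) = map g xs \<and>
    (\<forall>u\<in>set xs. \<forall>v\<in>set xs. u < v \<longrightarrow> g v < g u \<longrightarrow> separated xs u v)"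
  using assms
proof (induction xs arbitrary: f rule: distinct_max_induct)
  case Nil
  then show ?case by (simp add: bij_P_Nil)
next
  case (split a m b)
  let ?xs = "a @ m # b"
  \<comment> \<open>Sortedness of S(xs) takes the place of avoiding 231: it passes to
    \<open>a\<close> and \<open>b\<close> and puts the entries of \<open>a\<close> below those of
    \<open>b\<close>.\<close>
  have S: "sorted (stack_sort a @ stack_sort b @ [m])"
    using split.prems(1) split.hyps by (simp add: stack_sort_append)
  have part: "\<exists>g. bij_P (standardize (map f c)) = map g c \<and>
      (\<forall>u\<in>set c. \<forall>v\<in>set c. u < v \<longrightarrow> g v < g u \<longrightarrow> separated c u v)"
    if c: "set c \<subseteq> set ?xs" and IH: "\<And>f. strict_mono_on (set c) f \<Longrightarrow>
      \<exists>g. bij_P (map f c) = map g c \<and>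
        (\<forall>u\<in>set c. \<forall>v\<in>set c. u < v \<longrightarrow> g v < g u \<longrightarrow> separated c u v)" for c
  proof -
    obtain h where h: "standardize (map f c) = map h (map f c)" "strict_mono_on (set (map f c)) h"
      by (rule standardize_strict_mono_on)
    have "strict_mono_on (set c) (h \<circ> f)"
      using h(2) split.prems(2) c unfolding strict_mono_on_def by (simp add: subset_iff)
    from IH[OF this] show ?thesis using h(1) by simp
  qed
  obtain g1 where g1: "bij_P (standardize (map f a)) = map g1 a"
    and sep1: "\<And>u v. u \<in> set a \<Longrightarrow> v \<in> set a \<Longrightarrow> u < v \<Longrightarrow> g1 v < g1 u \<Longrightarrow> separated a u v"
    using part[OF _ split.IH(1)] S by (fastforce simp: sorted_append)
  obtain g2 where g2: "bij_P (standardize (map f b)) = map g2 b"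
    and sep2: "\<And>u v. u \<in> set b \<Longrightarrow> v \<in> set b \<Longrightarrow> u < v \<Longrightarrow> g2 v < g2 u \<Longrightarrow> separated b u v"
    using part[OF _ split.IH(2)] S by (fastforce simp: sorted_append)
  have f_lt: "y < f m" if "y \<in> set (map f a) \<union> set (map f b)" for y
    using that split.prems(2) split.hyps by (auto simp: strict_mono_on_def)
  have inj: "inj_on f (set ?xs)" using split.prems(2) by (rule strict_mono_on_imp_inj_on)
  have perm: "is_perm (bij_P (standardize (map f c)))" if "set c \<subseteq> set ?xs" "distinct c" for c
  proof -
    have "distinct (map f c)" using that inj by (meson distinct_map inj_on_subset)
    then have "distinct (standardize (map f c))" using is_perm_standardize is_perm_iff by blast
    then show ?thesis by (rule is_perm_bij_P)
  qed
  have "is_perm (map g1 a)" "is_perm (map g2 b)"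
    using perm[of a] perm[of b] split.hyps(1) by (auto simp: g1 g2)
  then have bounds: "x \<in> set a \<Longrightarrow> g1 x \<le> length a" "x \<in> set b \<Longrightarrow> g2 x \<le> length b" for x
    by (auto simp: is_perm_iff)
  \<comment> \<open>The values are read off from the skew sum: the first block and the maximum are
    raised above all values of the second block.\<close>
  define g where "g x = (if x \<in> set a then g1 x + length b
    else if x = m then length a + 1 + length b else g2 x)" for x
  have disj: "x \<notin> set a" "x \<noteq> m" if "x \<in> set b" for x using that split.hyps(1) by auto
  have m: "m \<notin> set a" using split.hyps(1) by simp
  have "bij_P (map f ?xs) = (bij_P (standardize (map f a)) \<oplus>\<^sub>p [1]) \<ominus>\<^sub>p bij_P (standardize (map f b))"
    using split_max_append(2,3)[of "map f a" "f m" "map f b"] f_lt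
    by (subst bij_P.simps) simp
  also have "\<dots> = map g ?xs"
    using disj m by (simp add: g1 g2 dsum_def skew_sum_def g_def)
  finally have eq: "bij_P (map f ?xs) = map g ?xs" .
  have subs: "subseq a ?xs" "subseq b ?xs" by auto
  have "separated ?xs u v" if u: "u \<in> set ?xs" and v: "v \<in> set ?xs" and uv: "u < v" "g v < g u" for u v
  proof -
    \<comment> \<open>\<open>m\<close> is the largest entry and receives the largest value under
      \<open>g\<close>, so it belongs to no inverted pair.\<close>
    have um: "u \<noteq> m" using v uv(1) split.hyps by (auto dest: less_asym)
    have vm: "v \<noteq> m" using uv(2) u bounds m um disj by (fastforce simp: g_def split: if_splits)
    consider "u \<in> set a" "v \<in> set a" | "u \<in> set b" "v \<in> set b" | "u \<in> set a" "v \<in> set b"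
      | "u \<in> set b" "v \<in> set a" using u v um vm by auto
    then show ?thesis
    proof cases
      case 1
      then show ?thesis using sep1 uv subs separated_mono by (simp add: g_def) blast
    next
      case 2
      then show ?thesis using sep2 uv subs separated_mono disj by (simp add: g_def) blast
    next
      \<comment> \<open>These are the pairs inverted by the skew sum itself; \<open>m\<close> lies
        between them.\<close>
      case 3
      then show ?thesis using split.hyps by (intro separated_splitI) auto
    next
      case 4
      then have "v \<le> u" using S by (simp add: sorted_append)
      then show ?thesis using uv(1) by simp
    qed
  qed
  then show ?case using eq by blast
qed

text \<open>The relabelling \<open>g\<close> obtained from \<open>bij_P_map_inversions\<close> for
  the identity map agrees with \<open>lam \<pi>\<close> on the entries of \<open>\<pi>\<close>,
  since both carry \<open>\<pi>\<close> to \<open>bij_P \<pi>\<close>.\<close>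

lemma lam_inversions:
  assumes "is_perm \<pi>" "sorted (stack_sort \<pi>)" "u \<in> set \<pi>" "v \<in> set \<pi>" "u < v"
    and "lam \<pi> ! (v - 1) < lam \<pi> ! (u - 1)"
  shows "separated \<pi> u v"
proof -
  have "distinct \<pi>" using assms(1) by (simp add: is_perm_iff)
  then obtain g where g: "bij_P \<pi> = map g \<pi>"
    "\<forall>u\<in>set \<pi>. \<forall>v\<in>set \<pi>. u < v \<longrightarrow> g v < g u \<longrightarrow> separated \<pi> u v"
    using bij_P_map_inversions[of \<pi> id] assms(2) strict_mono_on_id by fastforce
  have "lam \<pi> ! (x - 1) = g x" if "x \<in> set \<pi>" for x
    using g(1) lam_spec(3)[OF assms(1)] that by (simp add: perm_comp_def)
  then show ?thesis using g(2) assms(3-6) by simp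
qed


section \<open>Preservation of the statistics\<close>

text \<open>By monotonicity, exactly the values 1, ..., v have images up to the image of
  \<open>v\<close>; these two initial segments therefore have the same size.\<close>

lemma perm_fixes_upper:
  assumes "is_perm \<mu>" "v \<in> {1..length \<mu>}"
    and mono: "\<And>p q. 1 \<le> p \<Longrightarrow> p < q \<Longrightarrow> q \<le> length \<mu> \<Longrightarrow> v \<le> q \<Longrightarrow> \<mu> ! (p - 1) < \<mu> ! (q - 1)"
  shows "\<mu> ! (v - 1) = v"
proof -
  let ?n = "length \<mu>" and ?f = "\<lambda>i. \<mu> ! (i - 1)"
  have img: "?f ` {1..?n} = {1..?n}"
  proof -
    have "?f ` {1..?n} = (!) \<mu> ` ((\<lambda>i. i - 1) ` {1..?n})" by (simp add: image_image)
    also have "(\<lambda>i. i - 1) ` {1..?n} = {..<?n}" by (force simp: image_iff)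
    also have "(!) \<mu> ` {..<?n} = set \<mu>" by (auto simp: set_conv_nth)
    finally show ?thesis using assms(1) by (simp add: is_perm_iff)
  qed
  then have inj: "inj_on ?f {1..?n}" by (simp add: eq_card_imp_inj_on)
  \<comment> \<open>The larger member of the pair is \<open>v\<close> if \<open>y < v\<close> and
    \<open>y\<close> if \<open>v < y\<close>, so \<open>mono\<close> applies either way.\<close>
  have below: "y \<le> v \<longleftrightarrow> ?f y \<le> ?f v" if "y \<in> {1..?n}" for y
    using mono[of y v] mono[of v y] that assms(2) by (cases y v rule: linorder_cases) auto
  have "?f ` {1..v} = {1..?f v}"
  proof
    show "?f ` {1..v} \<subseteq> {1..?f v}" using below img assms(2) by fastforce
    show "{1..?f v} \<subseteq> ?f ` {1..v}"
    proof
      fix z assume z: "z \<in> {1..?f v}"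
      have "?f v \<in> {1..?n}" using img assms(2) by blast
      then have "z \<in> ?f ` {1..?n}" using z img by auto
      then show "z \<in> ?f ` {1..v}" using z below by auto
    qed
  qed
  moreover have "card (?f ` {1..v}) = v"
    using inj_on_subset[OF inj, of "{1..v}"] assms(2) by (subst card_image) auto
  ultimately show ?thesis by simp
qed

text \<open>An occurrence of \<open>ds\<close> in the image pulls back to the same positions of
  \<open>xs\<close>: the entries there have the same images as those of \<open>ds\<close>, and
  injectivity identifies them.\<close>

lemma subseq_map_inj_on_fixed:
  assumes "inj_on f (set xs)" "set ds \<subseteq> set xs" "\<And>d. d \<in> set ds \<Longrightarrow> f d = d"
  shows "subseq ds (map f xs) = subseq ds xs"
proof
  have fd: "map f ds = ds" using assms(3) by (simp add: map_idI)
  show "subseq ds (map f xs)" if "subseq ds xs"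
    using subseq_map[OF that, of f] unfolding fd .
  show "subseq ds xs" if sub: "subseq ds (map f xs)"
  proof -
    obtain N where "ds = nths (map f xs) N" using sub unfolding subseq_conv_nths by blast
    then have "map f ds = map f (nths xs N)" using fd by (simp add: nths_map)
    moreover have "inj_on f (set ds \<union> set (nths xs N))"
      using assms(1,2) set_nths_subset by (metis Un_least inj_on_subset)
    ultimately have "ds = nths xs N" by (simp add: inj_on_map_eq_map)
    then show ?thesis unfolding subseq_conv_nths by blast
  qed
qed

section \<open>The statistics and their invariance under maps fixing the top entries\<close>

lemma subseq_rev_upt_mono:
  assumes "subseq (rev [Suc n - j..<Suc n]) \<pi>" "i \<le> j" "j \<le> n"
  shows "subseq (rev [Suc n - i..<Suc n]) \<pi>"
proof -
  have "[Suc n - j..<Suc n] = [Suc n - j..<Suc n - i] @ [Suc n - i..<Suc n]"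
    using upt_add_eq_append[of "Suc n - j" "Suc n - i" i] assms(2,3) by (simp del: upt_Suc)
  then have "subseq [Suc n - i..<Suc n] [Suc n - j..<Suc n]" by (metis list_emb_append2 subseq_order.order_refl)
  then show ?thesis using assms(1) subseq_rev subseq_order.order_trans by blast
qed

lemma zeil_le: "zeil \<pi> \<le> length \<pi>"
  and subseq_zeil: "subseq (rev [Suc (length \<pi>) - zeil \<pi>..<Suc (length \<pi>)]) \<pi>"
proof -
  let ?K = "{k. k \<le> length \<pi> \<and> subseq (rev [Suc (length \<pi>) - k..<Suc (length \<pi>)]) \<pi>}"
  have "0 \<in> ?K" by simp
  then have "Max ?K \<in> ?K" by (intro Max_in finite_Collect_conjI) (simp, blast)
  then show "zeil \<pi> \<le> length \<pi>" "subseq (rev [Suc (length \<pi>) - zeil \<pi>..<Suc (length \<pi>)]) \<pi>"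
    unfolding zeil_def by blast+
qed

lemma zeil_ge:
  "k \<le> length \<pi> \<Longrightarrow> subseq (rev [Suc (length \<pi>) - k..<Suc (length \<pi>)]) \<pi> \<Longrightarrow> k \<le> zeil \<pi>"
  unfolding zeil_def by (rule Max_ge) (simp_all del: upt_Suc)

lemma Rzeil_eq_zeil_rev: "Rzeil \<pi> = zeil (rev \<pi>)"
  by (simp add: Rzeil_def zeil_def subseq_rev del: upt_Suc)

text \<open>With k = \<open>zeil \<theta>\<close>, the fixed range reaches one below the run n, ...,
  n-k+1: fixing n-k too keeps the run from becoming longer.\<close>

lemma zeil_perm_comp:
  assumes \<theta>: "is_perm \<theta>" and \<mu>: "is_perm \<mu>" and len: "length \<mu> = length \<theta>"
    and fixed: "\<And>v. v \<in> {1..length \<theta>} \<Longrightarrow> length \<theta> - zeil \<theta> \<le> v \<Longrightarrow> \<mu> ! (v - 1) = v"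
  shows "zeil (\<mu> \<circ>\<^sub>p \<theta>) = zeil \<theta>"
proof -
  let ?n = "length \<theta>" and ?k = "zeil \<theta>" and ?f = "\<lambda>i. \<mu> ! (i - 1)"
  have set: "set \<theta> = {1..?n}" using \<theta> by (simp add: is_perm_iff)
  have "inj_on ?f (set \<theta>)"
    using \<mu> len unfolding set by (auto simp: inj_on_def is_perm_iff nth_eq_iff_index_eq)
  then have iff: "subseq (rev [Suc ?n - j..<Suc ?n]) (\<mu> \<circ>\<^sub>p \<theta>) =
      subseq (rev [Suc ?n - j..<Suc ?n]) \<theta>" if "j \<le> Suc ?k" "j \<le> ?n" for j
    unfolding perm_comp_def using that fixed set
    by (intro subseq_map_inj_on_fixed) auto
  have len': "length (\<mu> \<circ>\<^sub>p \<theta>) = ?n" by (simp add: perm_comp_def)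
  have "?k \<le> zeil (\<mu> \<circ>\<^sub>p \<theta>)"
    using zeil_ge[of ?k "\<mu> \<circ>\<^sub>p \<theta>"] iff[of ?k] zeil_le[of \<theta>] subseq_zeil[of \<theta>] len' by (simp del: upt_Suc)
  \<comment> \<open>A longer run contains the one of length k+1, which \<open>iff\<close> carries
    back to \<open>\<theta>\<close>.\<close>
  moreover have "\<not> Suc ?k \<le> zeil (\<mu> \<circ>\<^sub>p \<theta>)"
  proof
    assume k: "Suc ?k \<le> zeil (\<mu> \<circ>\<^sub>p \<theta>)"
    have z: "zeil (\<mu> \<circ>\<^sub>p \<theta>) \<le> ?n" using zeil_le len' by metis
    have "subseq (rev [Suc ?n - zeil (\<mu> \<circ>\<^sub>p \<theta>)..<Suc ?n]) (\<mu> \<circ>\<^sub>p \<theta>)"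
      using subseq_zeil[of "\<mu> \<circ>\<^sub>p \<theta>"] len' by (simp del: upt_Suc)
    then have "subseq (rev [Suc ?n - Suc ?k..<Suc ?n]) (\<mu> \<circ>\<^sub>p \<theta>)"
      using k z by (rule subseq_rev_upt_mono)
    then have "Suc ?k \<le> ?k" using iff[of "Suc ?k"] zeil_ge[of "Suc ?k" \<theta>] k z by simp
    then show False by simp
  qed
  ultimately show ?thesis by simp
qed

text \<open>\<open>\<sigma>\<close> is kept apart from \<open>\<theta>\<close> to serve both
  statistics: for \<open>zeil\<close> they coincide, while for \<open>Rzeil\<close> the reverse of
  an iterated sort is paired with \<open>rev \<theta>\<close>.\<close>

lemma zeil_perm_comp_inversions:
  assumes \<theta>: "is_perm \<theta>" and \<mu>: "is_perm \<mu>" "length \<mu> = length \<theta>"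
    and \<sigma>: "is_perm \<sigma>" "length \<sigma> = length \<theta>"
    and sub: "subseq (rev [Suc (length \<theta>) - zeil \<theta>..<Suc (length \<theta>)]) \<sigma>"
    and sep: "\<And>p q. p \<in> {1..length \<theta>} \<Longrightarrow> q \<in> {1..length \<theta>} \<Longrightarrow> p < q \<Longrightarrow>
      \<mu> ! (q - 1) < \<mu> ! (p - 1) \<Longrightarrow> separated (stack_sort \<sigma>) p q"
  shows "zeil (\<mu> \<circ>\<^sub>p \<theta>) = zeil \<theta>"
proof (rule zeil_perm_comp[OF \<theta> \<mu>])
  let ?n = "length \<theta>" and ?k = "zeil \<theta>"
  let ?d = "[Suc ?n - ?k..<Suc ?n]"
  fix v assume v: "v \<in> {1..?n}" "?n - ?k \<le> v"
  have set: "set \<sigma> = {1..?n}" and dist: "distinct \<sigma>" using \<sigma> by (auto simp: is_perm_iff)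
  have "suffix (rev (rev ?d)) (stack_sort \<sigma>)"
    using dist sub set by (intro suffix_stack_sort) (auto simp: sorted_wrt_rev simp del: upt_Suc)
  then obtain ys where ys: "stack_sort \<sigma> = ys @ ?d" by (auto simp: suffix_def simp del: upt_Suc)
  show "\<mu> ! (v - 1) = v"
  proof (rule perm_fixes_upper[OF \<mu>(1)])
    show "v \<in> {1..length \<mu>}" using v \<mu> by simp
    fix p q assume pq: "1 \<le> p" "p < q" "q \<le> length \<mu>" "v \<le> q"
    have "\<not> separated (stack_sort \<sigma>) p q"
      using ys
    proof (rule not_separated_sorted_suffix[rotated])
      \<comment> \<open>Off by one: \<open>q\<close> is at least n-k, so anything above it is at
        least n-k+1 and lies in the sorted tail.\<close>
      show "w \<in> set ?d" if "w \<in> set (stack_sort \<sigma>)" "q < w" for w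
        using that pq v set by auto
    qed (use dist in \<open>auto simp del: upt_Suc\<close>)
    then have "\<not> \<mu> ! (q - 1) < \<mu> ! (p - 1)" using sep[of p q] pq \<mu> by auto
    moreover have "\<mu> ! (q - 1) \<noteq> \<mu> ! (p - 1)"
      using \<mu> pq by (subst nth_eq_iff_index_eq) (auto simp: is_perm_iff)
    ultimately show "\<mu> ! (p - 1) < \<mu> ! (q - 1)" by simp
  qed
qed

section \<open>Iterated sorting and words containing S o R\<close>

lemma subseq_funpow_stack_sort:
  assumes "distinct xs" "sorted_wrt (<) zs" "subseq zs xs"
  shows "subseq zs ((stack_sort ^^ j) xs)"
proof -
  have "distinct ((stack_sort ^^ j) xs) \<and> subseq zs ((stack_sort ^^ j) xs)"
    using assms by (induction j) (auto intro: subseq_stack_sort)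
  then show ?thesis ..
qed

lemma compose_replicate_Srt: "compose (replicate j Srt) = stack_sort ^^ j"
  by (induction j) (simp_all add: compose_simps)

text \<open>Take the last occurrence of SR in the reduced word. The next letter is not R, as RR is
  absent, and the first R further on would follow an S and give a later SR; so only S
  remains.\<close>

lemma contains_SR_split:
  assumes "contains_SR w"
  obtains u j where "cancel_RR w = u @ Srt # Rvs # replicate j Srt"
proof -
  have "\<exists>u j. x = u @ Srt # Rvs # replicate j Srt"
    if "sublist [Srt, Rvs] x" "\<not> sublist [Rvs, Rvs] x" for x
    using that
  proof (induction x)
    case (Cons f x)
    show ?case
    proof (cases "sublist [Srt, Rvs] x")
      case True
      moreover have "\<not> sublist [Rvs, Rvs] x" using Cons.prems(2) by (auto simp: sublist_Cons_right)
      ultimately show ?thesis using Cons.IH by (metis append_Cons)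
    next
      case False
      then obtain y where y: "f # x = Srt # Rvs # y"
        using Cons.prems(1) by (auto simp: sublist_Cons_right prefix_def)
      have no: "\<not> prefix [Rvs] y" "\<not> sublist [Srt, Rvs] y"
        using Cons.prems(2) False y by (auto simp: sublist_Cons_right)
      have "set z \<subseteq> {Srt}" if "\<not> prefix [Rvs] z" "\<not> sublist [Srt, Rvs] z" for z
        using that
      proof (induction z)
        case (Cons g z)
        then show ?case by (cases g) (auto simp: sublist_Cons_right)
      qed simp
      from this[OF no] have "y = replicate (length y) Srt"
        by (intro replicate_eqI) auto
      then show ?thesis using y by (metis append_Nil)
    qed
  qed simp
  from this[OF _ not_sublist_cancel_RR] assms that show ?thesis
    unfolding contains_SR_def by blast
qed

theorem theorem4p12:
  fixes w :: "sr_op list" and A :: "nat list \<Rightarrow> nat list"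
  assumes "A = compose w \<circ> stack_sort"
  shows "(\<forall>\<theta>. is_perm \<theta> \<and> sorted_by (stack_sort \<circ> A) \<theta> \<longrightarrow> zeil (Phi A \<theta>) = zeil \<theta>)
       \<and> (contains_SR w \<longrightarrow>
            (\<forall>\<theta>. is_perm \<theta> \<and> sorted_by (stack_sort \<circ> A) \<theta> \<longrightarrow> Rzeil (Phi A \<theta>) = Rzeil \<theta>))"
proof -
  have mset_A: "mset (A \<theta>) = mset \<theta>" for \<theta>
    by (simp add: assms mset_compose mset_stack_sort)
  have lam: "is_perm (lam (A \<theta>))" "length (lam (A \<theta>)) = length \<theta>" if "is_perm \<theta>" for \<theta>
    using lam_spec[of "A \<theta>"] that is_perm_mset_cong[OF mset_A] mset_eq_length[OF mset_A] by auto
  have inv: "separated (A \<theta>) p q"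
    if "is_perm \<theta>" "sorted_by (stack_sort \<circ> A) \<theta>" "p \<in> {1..length \<theta>}" "q \<in> {1..length \<theta>}"
      "p < q" "lam (A \<theta>) ! (q - 1) < lam (A \<theta>) ! (p - 1)" for \<theta> p q
  proof (rule lam_inversions)
    show "sorted (stack_sort (A \<theta>))"
      using that(2) by (simp add: sorted_by_def id_perm_def del: upt_Suc)
  qed (use that is_perm_mset_cong[OF mset_A] mset_eq_setD[OF mset_A] mset_eq_length[OF mset_A] in \<open>auto simp: is_perm_iff\<close>)
  have "zeil (Phi A \<theta>) = zeil \<theta>" if \<theta>: "is_perm \<theta>" "sorted_by (stack_sort \<circ> A) \<theta>" for \<theta>
    unfolding Phi_def
  \<comment> \<open>Here \<sigma> = \<theta>: the S applied first in A creates the increasing tail,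
    and separation is carried back through \<open>compose w\<close>.\<close>
  proof (rule zeil_perm_comp_inversions[OF \<theta>(1) lam[OF \<theta>(1)] \<theta>(1) refl subseq_zeil])
    fix p q assume "p \<in> {1..length \<theta>}" "q \<in> {1..length \<theta>}" "p < q"
      "lam (A \<theta>) ! (q - 1) < lam (A \<theta>) ! (p - 1)"
    from inv[OF \<theta> this] show "separated (stack_sort \<theta>) p q"
      using \<theta>(1) by (auto simp: assms is_perm_iff intro: separated_compose)
  qed
  moreover have "Rzeil (Phi A \<theta>) = Rzeil \<theta>"
    if SR: "contains_SR w" and \<theta>: "is_perm \<theta>" "sorted_by (stack_sort \<circ> A) \<theta>" for \<theta>
  proof -
    obtain u j where "cancel_RR w = u @ Srt # Rvs # replicate j Srt"
      using SR by (rule contains_SR_split)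
    then have "compose w = compose u \<circ> (stack_sort \<circ> (rev \<circ> (stack_sort ^^ j)))"
      using compose_cancel_RR[of w] by (simp add: compose_append compose_simps compose_replicate_Srt)
    \<comment> \<open>The S built into A joins the \<open>j\<close> copies applied before R, hence
      \<open>Suc j\<close>.\<close>
    then have A: "A \<theta> = compose u (stack_sort (rev ((stack_sort ^^ Suc j) \<theta>)))"
      by (simp add: assms funpow_swap1)
    let ?\<sigma> = "rev ((stack_sort ^^ Suc j) \<theta>)" and ?n = "length \<theta>"
    have mset: "mset ?\<sigma> = mset \<theta>"
      using mset_compose[of "replicate (Suc j) Srt" \<theta>] by (simp only: compose_replicate_Srt mset_rev)
    have \<sigma>: "is_perm ?\<sigma>" "length ?\<sigma> = length (rev \<theta>)"
      using is_perm_mset_cong[OF mset] mset_eq_length[OF mset] \<theta>(1) by simp_all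
    have rev\<theta>: "is_perm (rev \<theta>)" using \<theta>(1) by (simp add: is_perm_iff)
    \<comment> \<open>The run counted by \<open>zeil (rev \<theta>)\<close> is increasing in
      \<open>\<theta>\<close>, survives the sorting passes and is decreasing in
      \<open>?\<sigma>\<close>.\<close>
    have "subseq [Suc ?n - zeil (rev \<theta>)..<Suc ?n] \<theta>"
      using subseq_zeil[of "rev \<theta>"] by (simp add: subseq_rev del: upt_Suc)
    then have "subseq [Suc ?n - zeil (rev \<theta>)..<Suc ?n] ((stack_sort ^^ Suc j) \<theta>)"
      using \<theta>(1) by (intro subseq_funpow_stack_sort) (auto simp: is_perm_iff simp del: upt_Suc)
    then have sub: "subseq (rev [Suc (length (rev \<theta>)) - zeil (rev \<theta>)..<Suc (length (rev \<theta>))]) ?\<sigma>"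
      by (simp add: subseq_rev del: upt_Suc funpow.simps)
    \<comment> \<open>Left composition acts on values and commutes with reversal, so this is the
      claim for \<open>Rzeil\<close>.\<close>
    have "zeil (lam (A \<theta>) \<circ>\<^sub>p rev \<theta>) = zeil (rev \<theta>)"
    proof (rule zeil_perm_comp_inversions[OF rev\<theta> lam(1)[OF \<theta>(1)] _ \<sigma> sub])
      fix p q assume "p \<in> {1..length (rev \<theta>)}" "q \<in> {1..length (rev \<theta>)}" "p < q"
        "lam (A \<theta>) ! (q - 1) < lam (A \<theta>) ! (p - 1)"
      then have "separated (A \<theta>) p q" using inv[OF \<theta>] by simp
      then show "separated (stack_sort ?\<sigma>) p q"
        unfolding A by (rule separated_compose[rotated]) (use \<sigma>(1) in \<open>simp add: is_perm_iff\<close>)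
    qed (simp add: lam[OF \<theta>(1)])
    then show ?thesis
      by (simp add: Rzeil_eq_zeil_rev Phi_def perm_comp_def rev_map)
  qed
  ultimately show ?thesis by blast
qed

end
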